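(* Let $S$ be a multiplicatively idempotent congruence-simple semiring possessing a multiplicatively absorbing element. Then $S$ is isomorphic to one of the two-element semirings $\mathbb{S}_1$, $\mathbb{S}_2$, $\mathbb{S}_3$ or $\mathbb{S}_4$ (defined in the context).
   Context: A semiring $S(+,\cdot)$ is a non-empty set with two associative binary operations such that the addition is commutative and the multiplication distributes over the addition from both sides (no zero or unity is assumed, and multiplication need not be commutative). It is multiplicatively idempotent if $x\cdot x=x$ for all $x\in S$. A congruence is an equivalence relation on $S$ compatible with both operations. $S$ is congruence-simple if it has exactly two congruences (namely $id_S$ and $S\times S$, so $|S|\ge 2$). An element $w\in S$ is multiplicatively absorbing if $xw=w=wx$ for every $x\in S$. The semirings $\mathbb{S}_1,\mathbb{S}_2,\mathbb{S}_3,\mathbb{S}_4$ have underlying set $\{w,a\}$ with $w\neq a$, the multiplication $w\cdot w=w\cdot a=a\cdot w=w$, $a\cdot a=a$, and the following additions: $\mathbb{S}_1$: $w+w=w$, $w+a=a+w=a$, $a+a=w$; $\mathbb{S}_2$: $w+w=w$, $w+a=a+w=a$, $a+a=a$; $\mathbb{S}_3$: $w+w=w$, $w+a=a+w=w$, $a+a=a$; $\mathbb{S}_4$: $w+w=w+a=a+w=a+a=w$. *)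

theory Defs
imports Main
begin

text \<open>
  A semiring is a type of class \<^class>\<open>semiring\<close>, which assumes neither a zero nor a unity
  and does not require the multiplication to be commutative.
\<close>

definition mult_idempotent :: "'a::semiring itself \<Rightarrow> bool" where
  "mult_idempotent _ \<longleftrightarrow> (\<forall>x::'a. x * x = x)"

definition mult_absorbing :: "'a::semiring \<Rightarrow> bool" where
  "mult_absorbing w \<longleftrightarrow> (\<forall>x. x * w = w \<and> w * x = w)"

definition congruence :: "('a::semiring \<times> 'a) set \<Rightarrow> bool" where
  "congruence r \<longleftrightarrow> equiv UNIV r \<and>
     (\<forall>x x' y y'. (x, x') \<in> r \<longrightarrow> (y, y') \<in> r \<longrightarrow>
        (x + y, x' + y') \<in> r \<and> (x * y, x' * y') \<in> r)"

text \<open>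
  The identity and the full relation are always congruences and coincide on a one-element
  semiring, so the following forces at least two elements. Since the cardinality of an infinite
  set is 0, it also excludes infinitely many congruences.
\<close>

definition congruence_simple :: "'a::semiring itself \<Rightarrow> bool" where
  "congruence_simple _ \<longleftrightarrow> card {r :: ('a \<times> 'a) set. congruence r} = 2"

definition semiring_iso :: "('a::semiring \<Rightarrow> 'b::semiring) \<Rightarrow> bool" where
  "semiring_iso f \<longleftrightarrow> bij f \<and>
     (\<forall>x y. f (x + y) = f x + f y) \<and> (\<forall>x y. f (x * y) = f x * f y)"

definition semiring_isomorphic :: "'a::semiring itself \<Rightarrow> 'b::semiring itself \<Rightarrow> bool" where
  "semiring_isomorphic _ _ \<longleftrightarrow> (\<exists>f :: 'a \<Rightarrow> 'b. semiring_iso f)"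

text \<open>
  The four two-element semirings share the multiplication, in which \<open>w\<close> is absorbing and
  \<open>a\<close> is a unity, and differ in the addition only.
\<close>

datatype S1 = w1 | a1

instantiation S1 :: semiring
begin

fun plus_S1 :: "S1 \<Rightarrow> S1 \<Rightarrow> S1" where
  "plus_S1 w1 w1 = w1"
| "plus_S1 w1 a1 = a1"
| "plus_S1 a1 w1 = a1"
| "plus_S1 a1 a1 = w1"

fun times_S1 :: "S1 \<Rightarrow> S1 \<Rightarrow> S1" where
  "times_S1 w1 w1 = w1"
| "times_S1 w1 a1 = w1"
| "times_S1 a1 w1 = w1"
| "times_S1 a1 a1 = a1"

instance
proof
  fix x y z :: S1
  show "x + y + z = x + (y + z)" by (cases x; cases y; cases z) simp_all
  show "x + y = y + x" by (cases x; cases y) simp_all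
  show "x * y * z = x * (y * z)" by (cases x; cases y; cases z) simp_all
  show "(x + y) * z = x * z + y * z" by (cases x; cases y; cases z) simp_all
  show "x * (y + z) = x * y + x * z" by (cases x; cases y; cases z) simp_all
qed

end

datatype S2 = w2 | a2

instantiation S2 :: semiring
begin

fun plus_S2 :: "S2 \<Rightarrow> S2 \<Rightarrow> S2" where
  "plus_S2 w2 w2 = w2"
| "plus_S2 w2 a2 = a2"
| "plus_S2 a2 w2 = a2"
| "plus_S2 a2 a2 = a2"

fun times_S2 :: "S2 \<Rightarrow> S2 \<Rightarrow> S2" where
  "times_S2 w2 w2 = w2"
| "times_S2 w2 a2 = w2"
| "times_S2 a2 w2 = w2"
| "times_S2 a2 a2 = a2"

instance
proof
  fix x y z :: S2
  show "x + y + z = x + (y + z)" by (cases x; cases y; cases z) simp_all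
  show "x + y = y + x" by (cases x; cases y) simp_all
  show "x * y * z = x * (y * z)" by (cases x; cases y; cases z) simp_all
  show "(x + y) * z = x * z + y * z" by (cases x; cases y; cases z) simp_all
  show "x * (y + z) = x * y + x * z" by (cases x; cases y; cases z) simp_all
qed

end

datatype S3 = w3 | a3

instantiation S3 :: semiring
begin

fun plus_S3 :: "S3 \<Rightarrow> S3 \<Rightarrow> S3" where
  "plus_S3 w3 w3 = w3"
| "plus_S3 w3 a3 = w3"
| "plus_S3 a3 w3 = w3"
| "plus_S3 a3 a3 = a3"

fun times_S3 :: "S3 \<Rightarrow> S3 \<Rightarrow> S3" where
  "times_S3 w3 w3 = w3"
| "times_S3 w3 a3 = w3"
| "times_S3 a3 w3 = w3"
| "times_S3 a3 a3 = a3"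

instance
proof
  fix x y z :: S3
  show "x + y + z = x + (y + z)" by (cases x; cases y; cases z) simp_all
  show "x + y = y + x" by (cases x; cases y) simp_all
  show "x * y * z = x * (y * z)" by (cases x; cases y; cases z) simp_all
  show "(x + y) * z = x * z + y * z" by (cases x; cases y; cases z) simp_all
  show "x * (y + z) = x * y + x * z" by (cases x; cases y; cases z) simp_all
qed

end

datatype S4 = w4 | a4

instantiation S4 :: semiring
begin

fun plus_S4 :: "S4 \<Rightarrow> S4 \<Rightarrow> S4" where
  "plus_S4 w4 w4 = w4"
| "plus_S4 w4 a4 = w4"
| "plus_S4 a4 w4 = w4"
| "plus_S4 a4 a4 = w4"

fun times_S4 :: "S4 \<Rightarrow> S4 \<Rightarrow> S4" where
  "times_S4 w4 w4 = w4"
| "times_S4 w4 a4 = w4"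
| "times_S4 a4 w4 = w4"
| "times_S4 a4 a4 = a4"

instance
proof
  fix x y z :: S4
  show "x + y + z = x + (y + z)" by (cases x; cases y; cases z) simp_all
  show "x + y = y + x" by (cases x; cases y) simp_all
  show "x * y * z = x * (y * z)" by (cases x; cases y; cases z) simp_all
  show "(x + y) * z = x * z + y * z" by (cases x; cases y; cases z) simp_all
  show "x * (y + z) = x * y + x * z" by (cases x; cases y; cases z) simp_all
qed

end

end

theory Submission
imports Defs
begin

text \<open>
  In a congruence-simple semiring an idempotent endomorphism fixing the absorbing element \<open>w\<close> is
  either the identity or constant. If the multiplication is commutative, this applies to
  \<open>x \<mapsto> a * x\<close>, so every \<open>a \<noteq> w\<close> is a unity and there is only one such element.

  For commutativity, apply the same dichotomy to \<open>x \<mapsto> x + w\<close> and \<open>x \<mapsto> x + x\<close>. Either \<open>w\<close> is a zero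
  and \<open>x + x = w\<close>, and the usual argument for Boolean rings works; or the syntactic
  congruence of \<open>{w}\<close>, which is not full and hence is the identity, relates \<open>x * y\<close> to \<open>y * x\<close>.
  The latter rests on the fact that \<open>x * y\<close> and \<open>y * x\<close> lie in the same class of the least
  semilattice congruence of the multiplicative band.
\<close>

section \<open>Congruences of a congruence-simple semiring\<close>

lemma congruence_Id: "congruence Id"
  by (auto simp: congruence_def equiv_def refl_on_def sym_def trans_def)

lemma congruence_UNIV: "congruence UNIV"
  by (auto simp: congruence_def equiv_def refl_on_def sym_def trans_def)

lemma congruence_kernel:
  fixes f :: "'a::semiring \<Rightarrow> 'b::semiring"
  assumes "\<And>x y. f (x + y) = f x + f y" "\<And>x y. f (x * y) = f x * f y"
  shows "congruence {(x, y). f x = f y}"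
  using assms by (auto simp: congruence_def equiv_def refl_on_def sym_def trans_def)

lemma congruence_simple_cases:
  fixes r :: "('a::semiring \<times> 'a) set"
  assumes "congruence_simple TYPE('a)" "congruence r"
  shows "r = Id \<or> r = UNIV"
proof -
  have "card {r :: ('a \<times> 'a) set. congruence r} = 2"
    using assms(1) by (simp add: congruence_simple_def)
  then obtain s t :: "('a \<times> 'a) set" where st: "{r. congruence r} = {s, t}" "s \<noteq> t"
    by (auto simp: card_2_iff)
  show ?thesis
  \<comment> \<open>\<open>Id\<close> and \<open>UNIV\<close> name the two congruences only if they
    differ; if they coincide, reflexivity alone makes \<open>r\<close> full.\<close>
  proof (cases "Id = (UNIV :: ('a \<times> 'a) set)")
    case True
    moreover have "Id \<subseteq> r"
      using assms(2) by (auto simp: congruence_def equiv_def refl_on_def)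
    ultimately show ?thesis
      by (simp add: top.extremum_unique)
  next
    case False
    have "c \<in> {s, t}" if "congruence c" for c
      using that st(1) by (metis mem_Collect_eq)
    from this[OF congruence_Id] this[OF congruence_UNIV] this[OF assms(2)] show ?thesis
      using False by auto
  qed
qed

lemma congruence_simple_nontrivial:
  assumes "congruence_simple TYPE('a::semiring)"
  shows "\<exists>a::'a. a \<noteq> w"
proof (rule ccontr)
  assume "\<not> ?thesis"
  then have eq: "c = w" for c
    by blast
  have "p \<in> Id" for p :: "'a \<times> 'a"
    using eq[of "fst p"] eq[of "snd p"] by (cases p) simp
  then have Id: "Id = (UNIV :: ('a \<times> 'a) set)"
    by blast
  have "r = UNIV" if "congruence r" for r :: "('a \<times> 'a) set"
    using congruence_simple_cases[OF assms that] Id by metis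
  then have "{r :: ('a \<times> 'a) set. congruence r} \<subseteq> {UNIV}"
    by blast
  then have "card {r :: ('a \<times> 'a) set. congruence r} \<le> card {UNIV :: ('a \<times> 'a) set}"
    by (intro card_mono) auto
  then show False
    using assms by (simp add: congruence_simple_def)
qed

section \<open>The divisibility preorder of a band\<close>

text \<open>In a band this is Green's J-preorder: \<open>q\<close> lies in the principal ideal of
  \<open>p\<close>. Its equivalence is the least semilattice congruence.\<close>

definition band_below :: "'a::semigroup_mult \<Rightarrow> 'a \<Rightarrow> bool" where
  "band_below q p \<longleftrightarrow> q * p * q = q"

locale band =
  fixes ty :: "'a::semigroup_mult itself"
  assumes idem: "x * x = (x::'a)"
begin

text \<open>Replacing the last \<open>q\<close> by \<open>q * u * v * q\<close> creates the square
  of \<open>q * u\<close>, which idempotence collapses.\<close>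

lemma cancel_right:
  fixes q :: 'a
  assumes "q * u * v * q = q"
  shows "q * u * q = q"
proof -
  have "q * u * q = q * u * (q * u * v * q)"
    by (simp only: assms)
  also have "\<dots> = (q * u) * (q * u) * (v * q)"
    by (simp only: mult.assoc)
  also have "\<dots> = q"
    using assms by (simp only: idem) (simp only: mult.assoc)
  finally show ?thesis .
qed

lemma cancel_left:
  fixes q :: 'a
  assumes "q * u * v * q = q"
  shows "q * v * q = q"
proof -
  have "q * v * q = (q * u * v * q) * v * q"
    by (simp only: assms)
  also have "\<dots> = q * u * ((v * q) * (v * q))"
    by (simp only: mult.assoc)
  also have "\<dots> = q"
    using assms by (simp only: idem) (simp only: mult.assoc)
  finally show ?thesis .
qed

text \<open>Any factorization of \<open>q\<close> through \<open>p\<close> suffices: the two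
  cancellation lemmas strip \<open>b\<close> and then \<open>a\<close>.\<close>

lemma band_belowI:
  fixes q :: 'a
  assumes "q * a * p * b * q = q"
  shows "band_below q p"
proof -
  have "q * (a * p) * b * q = q"
    using assms by (simp only: mult.assoc)
  then have "q * (a * p) * q = q"
    by (rule cancel_right)
  then have "q * a * p * q = q"
    by (simp only: mult.assoc)
  then show ?thesis
    unfolding band_below_def by (rule cancel_left)
qed

text \<open>With \<open>s = u * q\<close>, first \<open>s\<close> is below \<open>p\<close>, then
  below \<open>p * u\<close>; the square of \<open>p * u\<close> contains the factor
  \<open>u * p\<close>.\<close>

lemma band_below_mult_left:
  fixes q :: 'a
  assumes "band_below q p"
  shows "band_below (u * q) (u * p)"
proof -
  define s where "s = u * q"
  have "s * q * p * q * s = u * (q * q) * p * q * (u * q)"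
    by (simp only: s_def mult.assoc)
  also have "\<dots> = u * (q * p * q) * (u * q)"
    by (simp only: idem mult.assoc)
  also have "\<dots> = s"
    using assms by (simp only: band_below_def idem s_def)
  finally have sps: "s * p * s = s"
    using band_belowI[of s q p q] by (simp add: band_below_def)
  have "s * (p * u) * (q * p) * s = (s * p * s) * p * s"
    by (simp only: s_def mult.assoc)
  also have "\<dots> = s"
    by (simp only: sps)
  finally have spu: "s * (p * u) * s = s"
    by (rule cancel_right)
  have "s * p * (u * p) * u * s = s * ((p * u) * (p * u)) * s"
    by (simp only: mult.assoc)
  also have "\<dots> = s"
    by (simp only: idem spu)
  finally show ?thesis
    unfolding s_def by (rule band_belowI)
qed

lemma band_below_mult_right:
  fixes q :: 'a
  assumes "band_below q p"
  shows "band_below (q * v) (p * v)"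
proof -
  define s where "s = q * v"
  have "s * q * p * q * s = q * v * (q * p * (q * q)) * v"
    by (simp only: s_def mult.assoc)
  also have "\<dots> = q * v * (q * p * q) * v"
    by (simp only: idem)
  also have "\<dots> = (q * v) * (q * v)"
    using assms by (simp only: band_below_def mult.assoc)
  also have "\<dots> = s"
    by (simp only: idem s_def)
  finally have sps: "s * p * s = s"
    using band_belowI[of s q p q] by (simp add: band_below_def)
  have "s * (p * q) * (v * p) * s = s * p * (s * p * s)"
    by (simp only: s_def mult.assoc)
  also have "\<dots> = s"
    by (simp only: sps)
  finally have svp: "s * (v * p) * s = s"
    by (rule cancel_left)
  have "s * v * (p * v) * p * s = s * ((v * p) * (v * p)) * s"
    by (simp only: mult.assoc)
  also have "\<dots> = s"
    by (simp only: idem svp)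
  finally show ?thesis
    unfolding s_def by (rule band_belowI)
qed

lemma band_below_swap: "band_below (u * (x * y) * v) (u * (y * x) * (v::'a))"
proof -
  have "x * y * (y * x) * (x * y) = x * (y * y) * (x * x) * y"
    by (simp only: mult.assoc)
  also have "\<dots> = x * y * x * y"
    by (simp only: idem)
  also have "\<dots> = (x * y) * (x * y)"
    by (simp only: mult.assoc)
  finally have "band_below (x * y) (y * x)"
    by (simp only: band_below_def idem)
  then show ?thesis
    by (intro band_below_mult_right band_below_mult_left)
qed

end

section \<open>The syntactic congruence of a point\<close>

text \<open>By distributivity these two shapes of context are closed under adding or multiplying by
  a further element inside, which gives compatibility.\<close>

definition syntactic_cong :: "'a::semiring \<Rightarrow> ('a \<times> 'a) set" where
  "syntactic_cong w = {(x, y). \<forall>u v. (u * x * v = w \<longleftrightarrow> u * y * v = w) \<and>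
     (\<forall>z. u * x * v + z = w \<longleftrightarrow> u * y * v + z = w)}"

lemma congruence_syntactic: "congruence (syntactic_cong w)"
proof -
  have add: "(x + c, y + c) \<in> syntactic_cong w" if "(x, y) \<in> syntactic_cong w" for x y c
    using that by (simp add: syntactic_cong_def distrib_left distrib_right add.assoc)
  have left: "(c * x, c * y) \<in> syntactic_cong w" if "(x, y) \<in> syntactic_cong w" for x y c
    using that by (simp add: syntactic_cong_def flip: mult.assoc)
  have right: "(x * c, y * c) \<in> syntactic_cong w" if "(x, y) \<in> syntactic_cong w" for x y c
    using that by (simp add: syntactic_cong_def mult.assoc)
  have eq: "equiv UNIV (syntactic_cong w)"
    by (auto simp: syntactic_cong_def equiv_def refl_on_def sym_def trans_def)
  then have trans: "trans (syntactic_cong w)"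
    by (simp add: equiv_def)
  show ?thesis
    unfolding congruence_def
  proof (intro conjI allI impI)
    fix x x' y y'
    assume xy: "(x, x') \<in> syntactic_cong w" "(y, y') \<in> syntactic_cong w"
    show "(x + y, x' + y') \<in> syntactic_cong w"
      using transD[OF trans add[OF xy(1), of y] add[OF xy(2), of x', unfolded add.commute[of _ x']]] .
    show "(x * y, x' * y') \<in> syntactic_cong w"
      using transD[OF trans right[OF xy(1)] left[OF xy(2)]] .
  qed (rule eq)
qed

section \<open>Endomorphisms and commutativity\<close>

locale idem_simple_semiring =
  fixes w :: "'a::semiring"
  assumes mult_idem: "mult_idempotent TYPE('a)"
    and simple: "congruence_simple TYPE('a)"
    and absorbing: "mult_absorbing w"
begin

sublocale band "TYPE('a)"
  using mult_idem by unfold_locales (simp add: mult_idempotent_def)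

lemma absorb [simp]: "x * w = w" "w * x = w"
  using absorbing by (auto simp: mult_absorbing_def)

lemma w_add_w [simp]: "w + w = w"
  by (metis absorb(1) distrib_right)

lemma four_times: "x + x + (x + x) = x + (x::'a)"
proof -
  have "(x + x) * (x + x) = x * x + x * x + (x * x + x * x)"
    by (simp only: distrib_left distrib_right)
  then show ?thesis
    by (simp only: idem)
qed

text \<open>The kernel of \<open>f\<close> is a congruence. If it is \<open>Id\<close>, then
  \<open>f (f x) = f x\<close> forces \<open>f x = x\<close>; if it is full, \<open>f\<close> is
  constant with value \<open>f w\<close>.\<close>

lemma endomorphism_cases:
  fixes f :: "'a \<Rightarrow> 'a"
  assumes "\<And>x y. f (x + y) = f x + f y" "\<And>x y. f (x * y) = f x * f y"
    and "\<And>x. f (f x) = f x" "f w = w"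
  shows "(\<forall>x. f x = x) \<or> (\<forall>x. f x = w)"
proof -
  consider "{(x, y). f x = f y} = Id" | "{(x, y). f x = f y} = UNIV"
    using congruence_simple_cases[OF simple congruence_kernel[of f, OF assms(1,2)]] by blast
  then show ?thesis
  proof cases
    case 1
    then show ?thesis
      using assms(3) by blast
  next
    case 2
    then have "f x = f w" for x
      by blast
    then show ?thesis
      using assms(4) by simp
  qed
qed

lemma add_w_cases: "(\<forall>x. x + w = x) \<or> (\<forall>x. x + w = w)"
proof (rule endomorphism_cases)
  fix x y :: 'a
  show "x + y + w = x + w + (y + w)"
    by (metis w_add_w add.assoc add.left_commute)
  show "x * y + w = (x + w) * (y + w)"
    by (simp add: distrib_left distrib_right add.assoc)
  show "x + w + w = x + w"
    by (simp add: add.assoc)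
qed simp

lemma double_cases: "(\<forall>x::'a. x + x = x) \<or> (\<forall>x. x + x = w)"
proof (rule endomorphism_cases[where f = "\<lambda>x. x + x"])
  fix x y :: 'a
  show "x + y + (x + y) = x + x + (y + y)"
    by (simp add: ac_simps)
  show "x * y + x * y = (x + x) * (y + y)"
    by (simp add: distrib_left distrib_right four_times)
  show "x + x + (x + x) = x + x"
    by (rule four_times)
qed simp

text \<open>This carries the additive contexts of \<open>syntactic_cong\<close> along
  \<open>band_below\<close>.\<close>

lemma add_eq_w_transfer:
  assumes q: "band_below q p" and pz: "p + z = w"
    and w: "(\<forall>x. x + w = w) \<or> (\<forall>x. x + w = x) \<and> (\<forall>x::'a. x + x = x)"
  shows "q + z = w"
  using w
proof
  assume w: "\<forall>x. x + w = w"
  define t where "t = q + z"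
  \<comment> \<open>The summand \<open>q * q * q = q\<close> may be replaced by
    \<open>q * p * q\<close>.\<close>
  have "q * t * q = q * (p + z) * q"
    using q by (simp add: t_def band_below_def distrib_left distrib_right idem)
  then have qtq: "q * t * q = w"
    by (simp add: pz)
  \<comment> \<open>Here \<open>t\<close> is its own cube, and one summand of the expansion is
    \<open>q * t * q = w\<close>, which absorbs all others.\<close>
  have "t = (q + z) * t * (q + z)"
    by (simp add: t_def idem)
  also have "\<dots> = (q * t * z + z * t * q + z * t * z) + q * t * q"
    by (simp add: distrib_left distrib_right ac_simps)
  also have "\<dots> = w"
    using w qtq by simp
  finally show ?thesis
    by (simp add: t_def)
next
  assume w: "(\<forall>x. x + w = x) \<and> (\<forall>x::'a. x + x = x)"
  \<comment> \<open>Addition is a semilattice with least element \<open>w\<close>, so a sum equal to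
    \<open>w\<close> has only summands \<open>w\<close>.\<close>
  then have "p = w" "z = w"
    by (metis add.assoc add.commute pz)+
  moreover from this have "q = w"
    using q by (simp add: band_below_def)
  ultimately show ?thesis
    by simp
qed

lemma mult_commute: "x * y = y * (x::'a)"
proof (cases "(\<forall>x. x + w = w) \<or> (\<forall>x. x + w = x) \<and> (\<forall>x::'a. x + x = x)")
  case True
  \<comment> \<open>An element \<open>q\<close> below \<open>w\<close> is \<open>w\<close>, as
    \<open>q = q * w * q\<close>. Exchanging \<open>x\<close> and \<open>y\<close> gives the
    converse implications.\<close>
  have "u * (y * x) * v = w" if "u * (x * y) * v = w" for u v x y
    using band_below_swap[of u y x v] that by (simp add: band_below_def)
  moreover have "u * (y * x) * v + z = w" if "u * (x * y) * v + z = w" for u v x y z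
    using add_eq_w_transfer[OF band_below_swap that True] .
  ultimately have "(x * y, y * x) \<in> syntactic_cong w"
    unfolding syntactic_cong_def by blast
  moreover have "syntactic_cong w \<noteq> UNIV"
  proof
    obtain a where a: "a \<noteq> w"
      using congruence_simple_nontrivial[OF simple] by blast
    assume "syntactic_cong w = UNIV"
    then have "(a, w) \<in> syntactic_cong w"
      by simp
    \<comment> \<open>The context with \<open>u = v = a\<close> separates \<open>a\<close> from
      \<open>w\<close>.\<close>
    then have "a * a * a = w \<longleftrightarrow> a * w * a = w"
      unfolding syntactic_cong_def by blast
    then show False
      using a by (simp add: idem)
  qed
  ultimately show ?thesis
    using congruence_simple_cases[OF simple congruence_syntactic[of w]] by auto
next
  case False
  \<comment> \<open>The dichotomies leave only this: addition is a group of exponent two with zero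
    \<open>w\<close>.\<close>
  then have zero: "a + w = a" "a + a = w" for a
    using add_w_cases double_cases by blast+
  have cancel: "b = c" if "a + b = a + c" for a b c :: 'a
    using that by (metis zero add.assoc add.commute)
  have "x + y + (x * y + y * x) = (x + y) * (x + y)"
    unfolding distrib_left distrib_right by (simp add: idem ac_simps)
  also have "\<dots> = x + y + w"
    by (simp add: idem zero)
  finally have "x * y + y * x = x * y + x * y"
    using cancel zero by metis
  then show ?thesis
    using cancel by metis
qed

text \<open>Commutativity and idempotence make multiplication by \<open>a\<close> an endomorphism;
  it is not constantly \<open>w\<close>, since \<open>a * a = a\<close>.\<close>

lemma unity:
  assumes "a \<noteq> w"
  shows "a * x = x"
proof -
  have "(\<forall>x. a * x = x) \<or> (\<forall>x. a * x = w)"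
    by (rule endomorphism_cases) (metis distrib_left, metis idem mult_commute mult.assoc,
        metis idem mult.assoc, simp)
  then show ?thesis
    using assms idem by metis
qed

section \<open>Two elements and the four possible additions\<close>

lemma two_elements: "\<exists>a. a \<noteq> w \<and> (\<forall>x. x = w \<or> x = a)"
proof -
  obtain a where a: "a \<noteq> w"
    using congruence_simple_nontrivial[OF simple] by blast
  have "x = a" if "x \<noteq> w" for x
    using unity[OF a, of x] unity[OF that, of a] mult_commute[of a x] by simp
  then show ?thesis
    using a by blast
qed

text \<open>The conditionals say that \<open>a' + w'\<close> and \<open>a' + a'\<close> follow the
  pattern of \<open>a + w\<close> and \<open>a + a\<close>, so one argument serves all four
  models.\<close>

lemma isomorphic_two_element_semiring:
  fixes w' a' :: "'b::semiring"
  assumes a: "a \<noteq> w" and all: "\<And>x. x = w \<or> x = a"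
    and a': "a' \<noteq> w'" and all': "\<And>y. y = w' \<or> y = a'"
    and add: "w' + w' = w'" "a' + w' = (if a + w = w then w' else a')"
      "a' + a' = (if a + a = w then w' else a')"
    and mult: "w' * w' = w'" "a' * w' = w'" "w' * a' = w'" "a' * a' = a'"
  shows "semiring_isomorphic TYPE('a) TYPE('b)"
proof -
  define f where "f = (\<lambda>x. if x = w then w' else a')"
  have f: "f w = w'" "f a = a'"
    using a by (auto simp: f_def)
  have "inj f"
  proof (rule injI)
    fix x y
    assume "f x = f y"
    then show "x = y"
      using all[of x] all[of y] f a' by metis
  qed
  moreover have "\<exists>x. y = f x" for y
    using all'[of y] f by metis
  then have "surj f"
    by (simp add: surj_def)
  moreover have "f (x + y) = f x + f y" for x y
  proof -
    have *: "f (w + w) = f w + f w" "f (a + w) = f a + f w" "f (a + a) = f a + f a"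
      unfolding f add by (simp_all add: f_def)
    then have "f (w + a) = f w + f a"
      by (metis add.commute)
    with * show ?thesis
      using all[of x] all[of y] by (elim disjE) (simp_all only:)
  qed
  moreover have "f (x * y) = f x * f y" for x y
    using all[of x] all[of y] by (elim disjE) (simp_all only: f mult absorb idem)
  ultimately show ?thesis
    unfolding semiring_isomorphic_def semiring_iso_def bij_def by blast
qed

lemma isomorphic_two_element:
  "semiring_isomorphic TYPE('a) TYPE(S1) \<or> semiring_isomorphic TYPE('a) TYPE(S2) \<or>
   semiring_isomorphic TYPE('a) TYPE(S3) \<or> semiring_isomorphic TYPE('a) TYPE(S4)"
proof -
  obtain a where a: "a \<noteq> w" and all: "\<And>x. x = w \<or> x = a"
    using two_elements by blast
  note iso = isomorphic_two_element_semiring[OF a all]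
  \<comment> \<open>As \<open>w + w = w\<close> is forced, these two sums determine the addition;
    the cases follow the order \<open>S1\<close> to \<open>S4\<close>.\<close>
  consider "a + w = a" "a + a = w" | "a + w = a" "a + a = a"
    | "a + w = w" "a + a = a" | "a + w = w" "a + a = w"
    using all[of "a + w"] all[of "a + a"] by blast
  then show ?thesis
  proof cases
    case 1
    have "semiring_isomorphic TYPE('a) TYPE(S1)"
    proof (rule iso)
      show "y = w1 \<or> y = a1" for y
        by (cases y) simp_all
    qed (simp_all add: 1 a)
    then show ?thesis by simp
  next
    case 2
    have "semiring_isomorphic TYPE('a) TYPE(S2)"
    proof (rule iso)
      show "y = w2 \<or> y = a2" for y
        by (cases y) simp_all
    qed (simp_all add: 2 a)
    then show ?thesis by simp
  next
    case 3
    have "semiring_isomorphic TYPE('a) TYPE(S3)"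
    proof (rule iso)
      show "y = w3 \<or> y = a3" for y
        by (cases y) simp_all
    qed (simp_all add: 3 a)
    then show ?thesis by simp
  next
    case 4
    have "semiring_isomorphic TYPE('a) TYPE(S4)"
    proof (rule iso)
      show "y = w4 \<or> y = a4" for y
        by (cases y) simp_all
    qed (simp_all add: 4 a)
    then show ?thesis by simp
  qed
qed

end

theorem theorem3p2:
  assumes "mult_idempotent TYPE('a::semiring)"
    and "congruence_simple TYPE('a)"
    and "\<exists>w::'a. mult_absorbing w"
  shows "semiring_isomorphic TYPE('a) TYPE(S1) \<or>
         semiring_isomorphic TYPE('a) TYPE(S2) \<or>
         semiring_isomorphic TYPE('a) TYPE(S3) \<or>
         semiring_isomorphic TYPE('a) TYPE(S4)"
proof -
  obtain w :: 'a where "mult_absorbing w"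
    using assms(3) by blast
  then interpret idem_simple_semiring w
    using assms(1,2) by unfold_locales
  show ?thesis
    by (rule isomorphic_two_element)
qed

end
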